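(* For $A,B\in\widehat{\mathbb{F}_q^{*}}$, $$ {}_{2}F_1\!\left(\begin{array}{cc} A, & B\\ & A\bar{B}\end{array}\Big|\;-1\right)_q^{\star}=\begin{cases}0 & \text{if } A \text{ is not a square},\\[4pt] \displaystyle\sum_{R^2=A}\frac{g(R)\,g(\bar{R}B)\,R(-1)}{g(A)\,g(\bar{A}B)} & \text{otherwise.}\end{cases} $$
   Context: Let $q$ be a prime power and $\mathbb{F}_q$ the finite field with $q$ elements. $\widehat{\mathbb{F}_q^{*}}$ denotes the group of multiplicative characters of $\mathbb{F}_q^{*}$; every character $\chi$ (including the trivial character $\varepsilon$) is extended to $\mathbb{F}_q$ by $\chi(0):=0$. $\bar{\chi}$ denotes the inverse character, and juxtaposition denotes pointwise product of characters. Fix a non-trivial additive character $\theta$ of $\mathbb{F}_q$ and define the Gauss sum $g(\chi):=\sum_{x\in\mathbb{F}_q}\chi(x)\theta(x)$. For $A_0,A_1,B_1\in\widehat{\mathbb{F}_q^{*}}$ and $x\in\mathbb{F}_q$ define $$ {}_{2}F_1\!\left(\begin{array}{cc} A_0, & A_1\\ & B_1\end{array}\Big|\;x\right)_q^{\star}:=\frac{1}{q-1}\sum_{\chi\in\widehat{\mathbb{F}_q^{*}}}\frac{g(A_0\chi)}{g(A_0)}\frac{g(A_1\chi)}{g(A_1)}\frac{g(\overline{B_1\chi})}{g(\overline{B_1})}\,g(\bar{\chi})\,\chi(x). $$ "$A$ is a square" means $A=S^2$ for some character $S$; $\sum_{R^2=A}$ denotes the sum over all characters $R$ with $R^2=A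$.
   Formalization: The formal theorem additionally assumes that q is odd or B is non-trivial; for q even and B trivial the stated identity is false (e.g. q = 2, A = B = ε gives −1 on the left and 1 on the right). *)

theory Defs
  imports "HOL-Analysis.Analysis"
begin

text \<open>
  The finite field is a type of classes field and finite, with \<open>q = CARD('a)\<close>. A multiplicative
  character is a homomorphism from the group of nonzero elements to the nonzero complex numbers,
  extended by the value 0 at 0.
\<close>

definition mult_chars :: "('a::{field,finite} \<Rightarrow> complex) set" where
  "mult_chars = {\<psi>. \<psi> 0 = 0 \<and> (\<forall>x. x \<noteq> 0 \<longrightarrow> \<psi> x \<noteq> 0) \<and>
     (\<forall>x y. x \<noteq> 0 \<longrightarrow> y \<noteq> 0 \<longrightarrow> \<psi> (x * y) = \<psi> x * \<psi> y)}"

text \<open>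
  The trivial character is needed to exclude the case of even \<open>q\<close> and trivial \<open>B\<close>, in which the
  evaluation at \<open>-1\<close> fails: for \<open>q = 2\<close> and trivial \<open>A\<close>, \<open>B\<close> the hypergeometric sum is \<open>-1\<close>, but the
  right-hand side is \<open>1\<close>.
\<close>

definition triv_char :: "'a::{field,finite} \<Rightarrow> complex" where
  "triv_char x = (if x = 0 then 0 else 1)"

definition char_mult ::
    "('a::{field,finite} \<Rightarrow> complex) \<Rightarrow> ('a \<Rightarrow> complex) \<Rightarrow> 'a \<Rightarrow> complex" (infixl \<open>\<odot>\<close> 70) where
  "(\<psi> \<odot> \<phi>) x = \<psi> x * \<phi> x"

text \<open>Since \<open>inverse 0 = 0\<close>, the inverse character also vanishes at 0.\<close>

definition char_inv :: "('a::{field,finite} \<Rightarrow> complex) \<Rightarrow> 'a \<Rightarrow> complex" where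
  "char_inv \<psi> x = inverse (\<psi> x)"

definition add_char :: "('a::{field,finite} \<Rightarrow> complex) \<Rightarrow> bool" where
  "add_char \<theta> \<longleftrightarrow> (\<forall>x. \<theta> x \<noteq> 0) \<and> (\<forall>x y. \<theta> (x + y) = \<theta> x * \<theta> y)"

definition nontrivial_add_char :: "('a::{field,finite} \<Rightarrow> complex) \<Rightarrow> bool" where
  "nontrivial_add_char \<theta> \<longleftrightarrow> add_char \<theta> \<and> (\<exists>x. \<theta> x \<noteq> 1)"

definition gauss_sum ::
    "('a::{field,finite} \<Rightarrow> complex) \<Rightarrow> ('a \<Rightarrow> complex) \<Rightarrow> complex" where
  "gauss_sum \<theta> \<psi> = (\<Sum>x\<in>UNIV. \<psi> x * \<theta> x)"

definition hyp2F1 ::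
    "('a::{field,finite} \<Rightarrow> complex) \<Rightarrow> ('a \<Rightarrow> complex) \<Rightarrow> ('a \<Rightarrow> complex) \<Rightarrow> ('a \<Rightarrow> complex) \<Rightarrow>
      'a \<Rightarrow> complex" where
  "hyp2F1 \<theta> A0 A1 B1 x =
     1 / (of_nat CARD('a) - 1) *
     (\<Sum>\<psi>\<in>mult_chars.
        gauss_sum \<theta> (A0 \<odot> \<psi>) / gauss_sum \<theta> A0 *
        (gauss_sum \<theta> (A1 \<odot> \<psi>) / gauss_sum \<theta> A1) *
        (gauss_sum \<theta> (char_inv (B1 \<odot> \<psi>)) / gauss_sum \<theta> (char_inv B1)) *
        gauss_sum \<theta> (char_inv \<psi>) * \<psi> x)"

definition square_char :: "('a::{field,finite} \<Rightarrow> complex) \<Rightarrow> bool" where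
  "square_char A \<longleftrightarrow> (\<exists>S\<in>mult_chars. A = S \<odot> S)"

text \<open>The sums over characters are genuine finite sums.\<close>

lemma mult_char_power:
  fixes \<psi> :: "'a::{field,finite} \<Rightarrow> complex"
  assumes "\<psi> \<in> mult_chars" "x \<noteq> 0"
  shows "\<psi> x ^ card (UNIV - {0::'a}) = 1"
proof -
  let ?U = "UNIV - {0::'a}"
  let ?P = "\<Prod>y\<in>?U. \<psi> y"
  have bij: "bij_betw (\<lambda>y. x * y) ?U ?U"
    using assms(2) by (intro bij_betwI[where g = "\<lambda>y. y / x"]) auto
  have "?P = (\<Prod>y\<in>?U. \<psi> (x * y))"
    using prod.reindex_bij_betw[OF bij, of \<psi>] by simp
  also have "\<dots> = (\<Prod>y\<in>?U. \<psi> x * \<psi> y)"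
    using assms by (intro prod.cong) (auto simp: mult_chars_def)
  also have "\<dots> = \<psi> x ^ card ?U * ?P"
    by (simp add: prod.distrib)
  finally have "?P = \<psi> x ^ card ?U * ?P" .
  moreover have "?P \<noteq> 0"
    using assms by (auto simp: mult_chars_def)
  ultimately show ?thesis by simp
qed

lemma finite_mult_chars: "finite (mult_chars :: ('a::{field,finite} \<Rightarrow> complex) set)"
proof -
  let ?n = "card (UNIV - {0::'a})"
  let ?Z = "insert 0 {z::complex. z ^ ?n = 1}"
  have "(1::'a) \<in> UNIV - {0}" by simp
  then have "?n > 0" by (metis card_gt_0_iff empty_iff finite)
  then have "finite ?Z"
    using finite_roots_unity[of ?n, where 'a = complex] by simp
  then have "finite (Pi\<^sub>E (UNIV :: 'a set) (\<lambda>_. ?Z))"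
    by (intro finite_PiE) auto
  moreover have "mult_chars \<subseteq> Pi\<^sub>E (UNIV :: 'a set) (\<lambda>_. ?Z)"
  proof
    fix \<psi> :: "'a \<Rightarrow> complex"
    assume \<psi>: "\<psi> \<in> mult_chars"
    have "\<psi> x \<in> ?Z" for x
      using \<psi> mult_char_power[OF \<psi>, of x] by (cases "x = 0") (auto simp: mult_chars_def)
    then show "\<psi> \<in> Pi\<^sub>E UNIV (\<lambda>_. ?Z)" by auto
  qed
  ultimately show ?thesis by (rule rev_finite_subset)
qed

end

theory Submission
  imports Defs "HOL-Number_Theory.Residues" "HOL-Algebra.Algebraic_Closure_Type"
begin

no_notation smult (infixl \<open>\<odot>\<index>\<close> 70)

text \<open>
  Let \<open>h(c)\<close> be the Gauss sum of \<open>B\<close> with respect to the additive character \<open>y \<mapsto> \<theta>(c y)\<close>. A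
  change of variables gives \<open>g(R) g(R\<inverse>B) = \<Sum>s. R(s) h(1 + s)\<close> for every character \<open>R\<close>. Pairing the
  four Gauss sums of the hypergeometric sum accordingly and summing over the characters leaves
  \<open>\<Sum>t. A(t) h(1 + t) h(1 - t)\<close>. Since \<open>h(a) h(b) = g(B) h(a b)\<close> unless \<open>a = b = 0\<close>, this is
  \<open>g(B) \<Sum>t. A(t) h(1 - t^2)\<close>, and \<open>(\<Sum>t | t^2 = s. A(t)) = (\<Sum>R | R^2 = A. R(s))\<close> turns it into a sum of
  products \<open>g(R) g(R\<inverse>B)\<close> again.
\<close>

section \<open>Calculus of multiplicative characters, including the value at 0\<close>

lemma mult_chars_zero: "\<psi> \<in> mult_chars \<Longrightarrow> \<psi> 0 = 0"
  by (simp add: mult_chars_def)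

lemma mult_chars_eq_0_iff: "\<psi> \<in> mult_chars \<Longrightarrow> \<psi> x = 0 \<longleftrightarrow> x = 0"
  by (auto simp: mult_chars_def)

lemma mult_chars_mult: "\<psi> \<in> mult_chars \<Longrightarrow> \<psi> (x * y) = \<psi> x * \<psi> y"
  by (cases "x = 0 \<or> y = 0") (auto simp: mult_chars_def)

lemma mult_chars_one: "\<psi> \<in> mult_chars \<Longrightarrow> \<psi> 1 = 1"
  using mult_chars_mult[of \<psi> 1 1] mult_chars_eq_0_iff[of \<psi> 1] by simp

lemma mult_chars_inverse: "\<psi> \<in> mult_chars \<Longrightarrow> \<psi> (inverse x) = inverse (\<psi> x)"
  using mult_chars_mult[of \<psi> x "inverse x"]
  by (cases "x = 0") (auto simp: mult_chars_zero mult_chars_one intro!: inverse_unique[symmetric])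

lemma triv_char_in_mult_chars: "triv_char \<in> mult_chars"
  by (simp add: mult_chars_def triv_char_def)

lemma char_mult_in_mult_chars: "\<psi> \<in> mult_chars \<Longrightarrow> \<phi> \<in> mult_chars \<Longrightarrow> \<psi> \<odot> \<phi> \<in> mult_chars"
  by (auto simp: mult_chars_def char_mult_def)

lemma char_inv_in_mult_chars: "\<psi> \<in> mult_chars \<Longrightarrow> char_inv \<psi> \<in> mult_chars"
  by (auto simp: mult_chars_def char_inv_def)

text \<open>Lets the sum of a quotient of two characters over the field detect whether they are
  equal.\<close>

lemma char_mult_char_inv_eq_triv_char_iff:
  assumes "\<psi> \<in> mult_chars" "\<phi> \<in> mult_chars"
  shows "\<psi> \<odot> char_inv \<phi> = triv_char \<longleftrightarrow> \<psi> = \<phi>"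
proof -
  have "\<psi> x * inverse (\<phi> x) = triv_char x \<longleftrightarrow> \<psi> x = \<phi> x" for x
    using mult_chars_zero[OF assms(1)] mult_chars_zero[OF assms(2)] mult_chars_eq_0_iff[OF assms(2), of x]
    by (cases "x = 0") (auto simp: triv_char_def field_simps)
  then show ?thesis
    by (simp add: fun_eq_iff char_mult_def char_inv_def)
qed

section \<open>Orthogonality relations for multiplicative characters\<close>

lemma sum_mult_char:
  fixes \<psi> :: "'a::{field,finite} \<Rightarrow> complex"
  assumes \<psi>: "\<psi> \<in> mult_chars"
  shows "(\<Sum>x\<in>UNIV. \<psi> x) = (if \<psi> = triv_char then of_nat CARD('a) - 1 else 0)"
proof (cases "\<psi> = triv_char")
  case True
  have "(\<Sum>x\<in>UNIV. triv_char (x::'a)) = (\<Sum>x\<in>UNIV - {0::'a}. 1::complex)"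
    by (rule sum.mono_neutral_cong_right) (auto simp: triv_char_def)
  also have "\<dots> = of_nat (CARD('a) - 1)"
    by (simp add: card_Diff_singleton)
  finally show ?thesis
    using True by (simp add: of_nat_diff Suc_leI)
next
  case False
  then obtain c where c: "c \<noteq> 0" "\<psi> c \<noteq> 1"
    using mult_chars_zero[OF \<psi>] by (auto simp: triv_char_def fun_eq_iff split: if_splits)
  have "(\<Sum>x\<in>UNIV. \<psi> x) = (\<Sum>x\<in>UNIV. \<psi> (c * x))"
    by (rule sum.reindex_bij_witness[of _ "\<lambda>x. c * x" "\<lambda>x. x / c"]) (use c in auto)
  also have "\<dots> = \<psi> c * (\<Sum>x\<in>UNIV. \<psi> x)"
    by (simp add: mult_chars_mult[OF \<psi>] sum_distrib_left)
  finally show ?thesis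
    using c False by simp
qed

text \<open>The multiplicative group of a finite field is cyclic; \<open>K\<close> repackages the
  type as a field with explicit carrier so that this known result applies. A generator makes it
  possible to construct characters explicitly.\<close>

lemma finite_field_generator:
  obtains a :: "'a::{field,finite}" where "a \<noteq> 0" "\<forall>x. x \<noteq> 0 \<longrightarrow> (\<exists>k::nat. x = a ^ k)"
proof -
  define K where "K = (ring_of_type_algebra :: 'a ring)"
  interpret K: Ring.field K
    unfolding K_def by (rule field_from_type_algebra)
  have carrier: "carrier K = UNIV" and zero: "\<zero>\<^bsub>K\<^esub> = 0"
    by (simp_all add: K_def ring_of_type_algebra_def)
  have pow: "x [^]\<^bsub>K\<^esub> (i::nat) = x ^ i" for x i
    by (induction i) (simp_all add: K_def ring_of_type_algebra_def mult.commute)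
  obtain a where a: "a \<in> carrier (mult_of K)"
      "carrier (mult_of K) = {a [^]\<^bsub>K\<^esub> i |i::nat. i \<in> UNIV}"
    using K.finite_field_mult_group_has_gen by (auto simp: carrier)
  have "carrier (mult_of K) = - {0}"
    by (auto simp: mult_of_simps carrier zero)
  with a that show thesis
    unfolding pow by auto
qed

text \<open>A generator \<open>a\<close> of order \<open>d\<close> is sent to the primitive root of
  unity \<open>exp (2 pi i / d)\<close>. If \<open>x = a ^ k\<close> is not 1, then \<open>d\<close>
  does not divide \<open>k\<close>, so the image of \<open>x\<close> is not 1 either.\<close>

lemma mult_char_separates:
  fixes x :: "'a::{field,finite}"
  assumes "x \<noteq> 0" "x \<noteq> 1"
  obtains \<psi> where "\<psi> \<in> mult_chars" "\<psi> x \<noteq> 1"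
proof -
  obtain a :: 'a where a: "a \<noteq> 0" "\<forall>x. x \<noteq> 0 \<longrightarrow> (\<exists>k::nat. x = a ^ k)"
    by (rule finite_field_generator)
  have pow_diff: "a ^ k = a ^ l \<longleftrightarrow> a ^ (l - k) = 1" if "k \<le> l" for k l
    using a(1) that power_add[of a k "l - k"] by simp
  have "\<not> inj (\<lambda>k::nat. a ^ k)"
    using finite_imageD[of "\<lambda>k::nat. a ^ k" UNIV] by auto
  then obtain k l :: nat where "a ^ k = a ^ l" "k < l"
    unfolding inj_def by (metis nat_neq_iff)
  then have ex: "\<exists>d>0. a ^ d = 1"
    using pow_diff[of k l] by (intro exI[of _ "l - k"]) auto
  define d where "d = (LEAST d. d > 0 \<and> a ^ d = 1)"
  have d: "d > 0" "a ^ d = 1"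
    using LeastI_ex[OF ex] by (auto simp: d_def)
  have a_pow: "a ^ k = 1 \<longleftrightarrow> d dvd k" for k
  proof
    assume "a ^ k = 1"
    moreover have "a ^ k = (a ^ d) ^ (k div d) * a ^ (k mod d)"
      by (simp flip: power_mult power_add)
    ultimately have "a ^ (k mod d) = 1"
      using d by simp
    moreover have "k mod d < d"
      using d by simp
    ultimately show "d dvd k"
      using not_less_Least[of "k mod d" "\<lambda>d. d > 0 \<and> a ^ d = 1"] by (auto simp: d_def[symmetric])
  qed (auto simp: power_mult d)
  define \<zeta> where "\<zeta> = exp (2 * complex_of_real pi * \<i> / of_nat d)"
  have \<zeta>_pow: "\<zeta> ^ k = 1 \<longleftrightarrow> d dvd k" for k
    using complex_root_unity_eq_1[of d k] d by (simp add: \<zeta>_def mult_ac flip: exp_of_nat_mult)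
  \<comment> \<open>The discrete logarithm is an arbitrary choice of exponent, additive only modulo
    \<open>d\<close>. This fact makes the character multiplicative nevertheless.\<close>
  have eq: "\<zeta> ^ k = \<zeta> ^ l" if "a ^ k = a ^ l" for k l
  proof -
    have *: "\<zeta> ^ k = \<zeta> ^ l" if "a ^ k = a ^ l" "k \<le> l" for k l
    proof -
      have "\<zeta> ^ (l - k) = 1"
        using that pow_diff[of k l] by (simp add: a_pow \<zeta>_pow)
      then show ?thesis
        using that power_add[of \<zeta> k "l - k"] by simp
    qed
    show ?thesis
      using that *[of k l] *[of l k] by (metis nat_le_linear)
  qed
  define dlog where "dlog y = (SOME k::nat. y = a ^ k)" for y
  have dlog: "a ^ dlog y = y" if "y \<noteq> 0" for y
    using someI_ex[OF a(2)[rule_format, OF that]] by (simp add: dlog_def)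
  define \<psi> where "\<psi> y = (if y = 0 then 0 else \<zeta> ^ dlog y)" for y
  have "\<zeta> ^ dlog (y * z) = \<zeta> ^ dlog y * \<zeta> ^ dlog z" if "y \<noteq> 0" "z \<noteq> 0" for y z
    unfolding power_add[symmetric] by (rule eq) (use that in \<open>simp add: dlog power_add\<close>)
  then have "\<psi> \<in> mult_chars"
    by (auto simp: mult_chars_def \<psi>_def \<zeta>_def)
  moreover have "\<psi> x \<noteq> 1"
    using assms dlog[of x] a_pow[of "dlog x"] by (simp add: \<psi>_def \<zeta>_pow)
  ultimately show thesis
    by (rule that)
qed

text \<open>For \<open>x\<close> other than 0 and 1, multiplication by a character that separates
  \<open>x\<close> from 1 permutes the characters and scales the sum by a factor different from 1.
  At \<open>x = 1\<close> the sum counts the characters.\<close>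

lemma sum_mult_chars:
  fixes x :: "'a::{field,finite}"
  shows "(\<Sum>\<psi>\<in>mult_chars. \<psi> x) = (if x = 1 then of_nat CARD('a) - 1 else 0)"
proof -
  have zero: "(\<Sum>\<psi>\<in>mult_chars. \<psi> x) = 0" if x: "x \<noteq> 1" for x :: 'a
  proof (cases "x = 0")
    case False
    then obtain \<phi> where \<phi>: "\<phi> \<in> mult_chars" "\<phi> x \<noteq> 1"
      using mult_char_separates[of x] x by metis
    have cancel: "\<phi> \<odot> (char_inv \<phi> \<odot> \<psi>) = \<psi>" "char_inv \<phi> \<odot> (\<phi> \<odot> \<psi>) = \<psi>"
      if "\<psi> \<in> mult_chars" for \<psi>
      using that \<phi>(1)
      by (auto simp: fun_eq_iff char_mult_def char_inv_def mult_chars_eq_0_iff field_simps)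
    have "(\<Sum>\<psi>\<in>mult_chars. \<psi> x) = (\<Sum>\<psi>\<in>mult_chars. (\<phi> \<odot> \<psi>) x)"
      by (rule sum.reindex_bij_witness[of _ "\<lambda>\<psi>. \<phi> \<odot> \<psi>" "\<lambda>\<psi>. char_inv \<phi> \<odot> \<psi>"])
        (auto simp: cancel \<phi> char_mult_in_mult_chars char_inv_in_mult_chars)
    also have "\<dots> = \<phi> x * (\<Sum>\<psi>\<in>mult_chars. \<psi> x)"
      by (simp add: char_mult_def sum_distrib_left)
    finally show ?thesis
      using \<phi> by simp
  qed (simp add: mult_chars_zero)
  \<comment> \<open>Double counting over all pairs of a character and a field element: one order of
    summation leaves only \<open>y = 1\<close>, the other only the trivial character.\<close>
  have "(\<Sum>\<psi>\<in>mult_chars. \<psi> (1::'a)) = (\<Sum>y\<in>(UNIV :: 'a set). if y = 1 then \<Sum>\<psi>\<in>mult_chars. \<psi> (1::'a) else 0)"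
    by simp
  also have "\<dots> = (\<Sum>y\<in>UNIV. \<Sum>\<psi>\<in>mult_chars. \<psi> (y::'a))"
    by (rule sum.cong) (simp_all add: zero)
  also have "\<dots> = (\<Sum>\<psi>\<in>mult_chars. \<Sum>y\<in>UNIV. \<psi> (y::'a))"
    by (rule sum.swap)
  also have "\<dots> = (\<Sum>\<psi>\<in>(mult_chars :: ('a \<Rightarrow> complex) set). if \<psi> = triv_char then of_nat CARD('a) - 1 else 0)"
    by (rule sum.cong) (simp_all add: sum_mult_char)
  also have "\<dots> = of_nat CARD('a) - 1"
    by (simp add: finite_mult_chars triv_char_in_mult_chars)
  finally show ?thesis
    using zero by simp
qed

lemma card_minus_1_neq_0: "of_nat CARD('a::{field,finite}) - 1 \<noteq> (0::complex)"
proof -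
  have "card {0, 1::'a} \<le> CARD('a)"
    by (rule card_mono) auto
  then have "CARD('a) \<noteq> 1"
    by simp
  then show ?thesis
    by (simp only: right_minus_eq of_nat_eq_1_iff not_False_eq_True)
qed

text \<open>Both orthogonality relations are used in turn: the condition
  \<open>A = R \<odot> R\<close> is expanded into the sum over \<open>t\<close> of
  \<open>A(t) / R(t)\<^sup>2\<close>, and after the interchange the sum of
  \<open>R(s / t\<^sup>2)\<close> over all \<open>R\<close> selects
  \<open>t\<^sup>2 = s\<close>.\<close>

lemma sum_square_root_chars:
  fixes A :: "'a::{field,finite} \<Rightarrow> complex"
  assumes A: "A \<in> mult_chars"
  shows "(\<Sum>R\<in>{R \<in> mult_chars. R \<odot> R = A}. R s) = (\<Sum>t\<in>{t. t\<^sup>2 = s}. A t)"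
proof -
  let ?q = "of_nat CARD('a) - 1 :: complex"
  have "?q * (\<Sum>R\<in>{R \<in> mult_chars. R \<odot> R = A}. R s) =
      (\<Sum>R\<in>mult_chars. R s * (if A = R \<odot> R then ?q else 0))"
    by (auto simp: sum_distrib_left finite_mult_chars mult.commute intro!: sum.mono_neutral_cong_left
        split: if_splits)
  also have "\<dots> = (\<Sum>R\<in>mult_chars. R s * (\<Sum>t\<in>UNIV. (A \<odot> char_inv (R \<odot> R)) t))"
    using A by (intro sum.cong refl)
      (simp add: sum_mult_char char_mult_in_mult_chars char_inv_in_mult_chars
        char_mult_char_inv_eq_triv_char_iff)
  also have "\<dots> = (\<Sum>R\<in>mult_chars. \<Sum>t\<in>UNIV. A t * R (s / t\<^sup>2))"
    by (intro sum.cong refl)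
      (simp add: sum_distrib_left char_mult_def char_inv_def divide_inverse mult_chars_mult
        mult_chars_inverse power2_eq_square mult_ac)
  also have "\<dots> = (\<Sum>t\<in>UNIV. A t * (\<Sum>R\<in>mult_chars. R (s / t\<^sup>2)))"
    by (subst sum.swap) (simp add: sum_distrib_left)
  \<comment> \<open>At \<open>t = 0\<close> the quotient is 0 by convention, so the character sum
    vanishes even if \<open>s = 0\<close>; the two sides agree there because
    \<open>A 0 = 0\<close>.\<close>
  also have "\<dots> = ?q * (\<Sum>t\<in>UNIV. if t\<^sup>2 = s then A t else 0)"
    unfolding sum_mult_chars sum_distrib_left
    by (intro sum.cong refl) (use A in \<open>auto simp: mult_chars_zero divide_eq_1_iff\<close>)
  also have "(\<Sum>t\<in>UNIV. if t\<^sup>2 = s then A t else 0) = (\<Sum>t\<in>{t. t\<^sup>2 = s}. A t)"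
    by (simp add: sum.If_cases)
  finally show ?thesis
    by (simp only: mult_left_cancel[OF card_minus_1_neq_0])
qed

section \<open>Gauss sums for rescaled additive characters, and products of two Gauss sums\<close>

definition twisted_gauss_sum ::
    "('a::{field,finite} \<Rightarrow> complex) \<Rightarrow> ('a \<Rightarrow> complex) \<Rightarrow> 'a \<Rightarrow> complex" where
  "twisted_gauss_sum \<theta> \<psi> c = (\<Sum>x\<in>UNIV. \<psi> x * \<theta> (c * x))"

lemma add_char_zero: "add_char \<theta> \<Longrightarrow> \<theta> 0 = 1"
  by (metis add_0 add_char_def mult_cancel_left2)

lemma twisted_gauss_sum_zero:
  "add_char \<theta> \<Longrightarrow> twisted_gauss_sum \<theta> \<psi> 0 = (\<Sum>x\<in>UNIV. \<psi> x)"
  by (simp add: twisted_gauss_sum_def add_char_zero)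

lemma twisted_gauss_sum_nonzero:
  assumes "\<psi> \<in> mult_chars" "c \<noteq> 0"
  shows "twisted_gauss_sum \<theta> \<psi> c = char_inv \<psi> c * gauss_sum \<theta> \<psi>"
proof -
  have "twisted_gauss_sum \<theta> \<psi> c = (\<Sum>x\<in>UNIV. \<psi> (inverse c * x) * \<theta> x)"
    unfolding twisted_gauss_sum_def
    by (rule sum.reindex_bij_witness[of _ "\<lambda>x. inverse c * x" "\<lambda>x. c * x"])
      (use assms in \<open>auto simp: field_simps\<close>)
  then show ?thesis
    using assms
    by (simp add: mult_chars_mult mult_chars_inverse gauss_sum_def char_inv_def sum_distrib_left mult_ac)
qed

text \<open>For nonzero \<open>a\<close> and \<open>b\<close> both sides are the square of the Gauss
  sum divided by \<open>\<psi> (a * b)\<close>. If one of them is 0, both sides vanish for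
  nontrivial \<psi>; for trivial \<psi> the twisted sum is constant away from 0, which settles the
  case of exactly one zero. In the excluded case the left side is \<open>(q - 1)\<^sup>2\<close>,
  the right side \<open>q - 1\<close> times the Gauss sum.\<close>

lemma twisted_gauss_sum_mult:
  assumes \<theta>: "add_char \<theta>" and \<psi>: "\<psi> \<in> mult_chars"
    and "a \<noteq> 0 \<or> b \<noteq> 0 \<or> \<psi> \<noteq> triv_char"
  shows "twisted_gauss_sum \<theta> \<psi> a * twisted_gauss_sum \<theta> \<psi> b =
    gauss_sum \<theta> \<psi> * twisted_gauss_sum \<theta> \<psi> (a * b)"
proof (cases "a = 0 \<or> b = 0")
  case False
  then show ?thesis
    using \<psi> by (simp add: twisted_gauss_sum_nonzero char_inv_def mult_chars_mult)
next
  case True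
  show ?thesis
  proof (cases "\<psi> = triv_char")
    case triv: True
    have "twisted_gauss_sum \<theta> \<psi> c = gauss_sum \<theta> \<psi>" if "c \<noteq> 0" for c
      using twisted_gauss_sum_nonzero[OF \<psi> that, of \<theta>] that
      by (simp add: triv char_inv_def triv_char_def)
    then show ?thesis
      using True triv assms(3) by auto
  next
    case False
    then have "twisted_gauss_sum \<theta> \<psi> 0 = 0"
      using \<theta> \<psi> by (simp add: twisted_gauss_sum_zero sum_mult_char)
    then show ?thesis
      using True by auto
  qed
qed

text \<open>Substituting \<open>x = s y\<close> in the double sum turns \<open>R(x) / R(y)\<close>
  into \<open>R(s)\<close> and the additive factors into \<open>\<theta>((1 + s) y)\<close>. Keeping
  the twisted sum at \<open>s = - 1\<close> avoids the exceptional cases of the Jacobi sum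
  formula.\<close>

lemma gauss_sum_mult:
  fixes R B :: "'a::{field,finite} \<Rightarrow> complex"
  assumes \<theta>: "add_char \<theta>" and R: "R \<in> mult_chars" and B: "B \<in> mult_chars"
  shows "gauss_sum \<theta> R * gauss_sum \<theta> (char_inv R \<odot> B) =
    (\<Sum>s\<in>UNIV. R s * twisted_gauss_sum \<theta> B (1 + s))"
proof -
  have \<theta>_add: "\<theta> (x + y) = \<theta> x * \<theta> y" for x y
    using \<theta> by (simp add: add_char_def)
  \<comment> \<open>The substitution is invalid at \<open>y = 0\<close>, but there both sides vanish
    because \<open>B 0 = 0\<close>.\<close>
  have inner: "inverse (R y) * (B y * \<theta> y) * (\<Sum>x\<in>UNIV. R x * \<theta> x) =
      (\<Sum>s\<in>UNIV. R s * (B y * \<theta> ((1 + s) * y)))" for y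
  proof (cases "y = 0")
    case False
    have reindex: "(\<Sum>x\<in>UNIV. R x * \<theta> x) = (\<Sum>s\<in>UNIV. R (s * y) * \<theta> (s * y))"
      by (rule sum.reindex_bij_witness[of _ "\<lambda>s. s * y" "\<lambda>x. x / y"]) (use False in auto)
    have "R y \<noteq> 0"
      using False R by (simp add: mult_chars_eq_0_iff)
    then show ?thesis
      unfolding reindex sum_distrib_left
      by (intro sum.cong refl) (simp add: mult_chars_mult[OF R] \<theta>_add distrib_right)
  qed (simp add: mult_chars_zero[OF B])
  have "gauss_sum \<theta> R * gauss_sum \<theta> (char_inv R \<odot> B) =
      (\<Sum>y\<in>UNIV. inverse (R y) * (B y * \<theta> y) * (\<Sum>x\<in>UNIV. R x * \<theta> x))"
    unfolding sum_distrib_right[symmetric]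
    by (simp add: gauss_sum_def char_mult_def char_inv_def mult_ac)
  also have "\<dots> = (\<Sum>s\<in>UNIV. R s * twisted_gauss_sum \<theta> B (1 + s))"
    unfolding inner unfolding twisted_gauss_sum_def sum_distrib_left by (rule sum.swap)
  finally show ?thesis .
qed

section \<open>Non-vanishing of Gauss sums\<close>

lemma sum_add_char:
  fixes \<theta> :: "'a::{field,finite} \<Rightarrow> complex"
  assumes "nontrivial_add_char \<theta>"
  shows "(\<Sum>x\<in>UNIV. \<theta> x) = 0"
proof -
  obtain c where c: "\<theta> c \<noteq> 1"
    using assms by (auto simp: nontrivial_add_char_def)
  have "(\<Sum>x\<in>UNIV. \<theta> x) = (\<Sum>x\<in>UNIV. \<theta> (c + x))"
    by (rule sum.reindex_bij_witness[of _ "\<lambda>x. c + x" "\<lambda>x. x - c"]) auto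
  also have "\<dots> = \<theta> c * (\<Sum>x\<in>UNIV. \<theta> x)"
    using assms by (simp add: nontrivial_add_char_def add_char_def sum_distrib_left)
  finally show ?thesis
    using c by simp
qed

lemma gauss_sum_triv_char:
  assumes "nontrivial_add_char \<theta>"
  shows "gauss_sum \<theta> triv_char = - 1"
proof -
  have "gauss_sum \<theta> triv_char = (\<Sum>x\<in>UNIV. \<theta> x - (if x = 0 then 1 else 0))"
    unfolding gauss_sum_def
    by (rule sum.cong)
      (use assms in \<open>auto simp: triv_char_def add_char_zero nontrivial_add_char_def\<close>)
  then show ?thesis
    using assms by (simp add: sum_subtractf sum_add_char)
qed

text \<open>For nontrivial \<psi>, the product of the Gauss sums of \<psi> and its inverse is
  \<open>q \<psi>(- 1)\<close>, obtained from \<open>gauss_sum_mult\<close> with the trivial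
  character as \<open>B\<close>.\<close>

lemma gauss_sum_neq_0:
  fixes \<psi> :: "'a::{field,finite} \<Rightarrow> complex"
  assumes \<theta>: "nontrivial_add_char \<theta>" and \<psi>: "\<psi> \<in> mult_chars"
  shows "gauss_sum \<theta> \<psi> \<noteq> 0"
proof (cases "\<psi> = triv_char")
  case True
  then show ?thesis
    using gauss_sum_triv_char[OF \<theta>] by simp
next
  case False
  have add: "add_char \<theta>"
    using \<theta> by (simp add: nontrivial_add_char_def)
  \<comment> \<open>As a function of \<open>c\<close> this is \<open>q\<close> times a point mass at
    0 minus a constant. The constant will contribute the sum of \<psi>, which is zero.\<close>
  have twist: "twisted_gauss_sum \<theta> triv_char c = (if c = 0 then of_nat CARD('a) else 0) - 1" for c
    using twisted_gauss_sum_nonzero[OF triv_char_in_mult_chars, of c \<theta>]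
    by (cases "c = 0")
      (simp_all add: twisted_gauss_sum_zero[OF add] sum_mult_char triv_char_in_mult_chars
        gauss_sum_triv_char[OF \<theta>], simp add: char_inv_def triv_char_def)
  have "gauss_sum \<theta> \<psi> * gauss_sum \<theta> (char_inv \<psi> \<odot> triv_char) =
      (\<Sum>s\<in>UNIV. (if s = - 1 then of_nat CARD('a) * \<psi> s else 0) - \<psi> s)"
    unfolding gauss_sum_mult[OF add \<psi> triv_char_in_mult_chars] twist
    by (intro sum.cong refl) (simp add: add_eq_0_iff right_diff_distrib)
  also have "\<dots> = of_nat CARD('a) * \<psi> (- 1)"
    using False by (simp add: sum_subtractf sum_mult_char[OF \<psi>])
  finally show ?thesis
    using mult_chars_eq_0_iff[OF \<psi>, of "- 1"] by auto
qed

section \<open>Odd order and the evaluation at \<open>- 1\<close>\<close>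

lemma two_neq_0_if_odd_card:
  assumes "odd CARD('a::{field,finite})"
  shows "(2::'a) \<noteq> 0"
proof
  assume "(2::'a) = 0"
  then have "of_nat 2 = (0::'a)"
    by simp
  then have "CHAR('a) dvd 2"
    by (simp only: of_nat_eq_0_iff_char_dvd)
  moreover have "CHAR('a) \<noteq> 1"
    using of_nat_CHAR[where 'a = 'a] by (metis of_nat_1 zero_neq_one)
  ultimately have "CHAR('a) = 2"
    using prime_nat_iff two_is_prime_nat by blast
  then show False
    using CHAR_dvd_CARD[where 'a = 'a] assms by simp
qed

theorem theorem4p1:
  fixes \<theta> A B :: "'a::{field,finite} \<Rightarrow> complex"
  assumes "nontrivial_add_char \<theta>"
    and "A \<in> mult_chars" and "B \<in> mult_chars"
    and "odd CARD('a) \<or> B \<noteq> triv_char"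
  shows "hyp2F1 \<theta> A B (A \<odot> char_inv B) (- 1) =
    (if \<not> square_char A then 0
     else (\<Sum>R\<in>{R \<in> mult_chars. R \<odot> R = A}.
       gauss_sum \<theta> R * gauss_sum \<theta> (char_inv R \<odot> B) * R (- 1) /
       (gauss_sum \<theta> A * gauss_sum \<theta> (char_inv A \<odot> B))))"
proof -
  let ?q = "of_nat CARD('a) - 1 :: complex"
  let ?Q = "{R \<in> mult_chars. R \<odot> R = A}"
  define g where "g = gauss_sum \<theta>"
  define h where "h = twisted_gauss_sum \<theta> B"
  have \<theta>: "add_char \<theta>"
    using assms(1) by (simp add: nontrivial_add_char_def)
  note A = assms(2) and B = assms(3)
  \<comment> \<open>Both arguments can vanish only if their sum 2 is zero, that is, for even
    \<open>q\<close>; then \<open>B\<close> is nontrivial by assumption, and the product rule still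
    applies.\<close>
  have h_mult: "h (1 + t) * h (1 - t) = g B * h (1 - t\<^sup>2)" for t
  proof -
    have "1 + t \<noteq> 0 \<or> 1 - t \<noteq> 0 \<or> B \<noteq> triv_char"
    proof (rule ccontr)
      assume contra: "\<not> ?thesis"
      then have "(1 + t) + (1 - t) = 0"
        by simp
      then have "(2::'a) = 0"
        by simp
      then show False
        using contra assms(4) two_neq_0_if_odd_card by blast
    qed
    from twisted_gauss_sum_mult[OF \<theta> B this] show ?thesis
      by (simp add: g_def h_def algebra_simps power2_eq_square)
  qed
  have "(\<Sum>\<psi>\<in>mult_chars. g (A \<odot> \<psi>) * g (B \<odot> \<psi>) * g (char_inv (A \<odot> char_inv B \<odot> \<psi>)) *
        g (char_inv \<psi>) * \<psi> (- 1)) =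
      (\<Sum>\<psi>\<in>mult_chars. \<Sum>t\<in>UNIV. \<Sum>s\<in>UNIV. A t * h (1 + t) * h (1 + s) * \<psi> (- 1 * (t / s)))"
  proof (rule sum.cong[OF refl])
    fix \<psi> :: "'a \<Rightarrow> complex"
    assume \<psi>: "\<psi> \<in> mult_chars"
    \<comment> \<open>These two identities dictate the pairing of the four Gauss sums:
      \<open>gauss_sum_mult\<close> is applied once with \<open>R = A \<odot> \<psi>\<close> and
      once with \<open>R = char_inv \<psi>\<close>.\<close>
    have 1: "char_inv (A \<odot> char_inv B \<odot> \<psi>) = char_inv (A \<odot> \<psi>) \<odot> B"
      by (simp add: char_inv_def char_mult_def fun_eq_iff)
    have 2: "B \<odot> \<psi> = char_inv (char_inv \<psi>) \<odot> B"
      by (simp add: char_inv_def char_mult_def fun_eq_iff)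
    have "g (A \<odot> \<psi>) * g (B \<odot> \<psi>) * g (char_inv (A \<odot> char_inv B \<odot> \<psi>)) * g (char_inv \<psi>) * \<psi> (- 1) =
        (g (A \<odot> \<psi>) * g (char_inv (A \<odot> \<psi>) \<odot> B)) *
        (g (char_inv \<psi>) * g (char_inv (char_inv \<psi>) \<odot> B)) * \<psi> (- 1)"
      unfolding 1 2 by (simp only: mult_ac)
    also have "\<dots> = (\<Sum>t\<in>UNIV. (A \<odot> \<psi>) t * h (1 + t)) * (\<Sum>s\<in>UNIV. char_inv \<psi> s * h (1 + s)) * \<psi> (- 1)"
      by (simp only: g_def h_def gauss_sum_mult[OF \<theta> _ B] A \<psi> char_mult_in_mult_chars
          char_inv_in_mult_chars)
    also have "\<dots> = (\<Sum>t\<in>UNIV. \<Sum>s\<in>UNIV. A t * h (1 + t) * h (1 + s) * \<psi> (- 1 * (t / s)))"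
      unfolding sum_product unfolding sum_distrib_right
      by (intro sum.cong refl)
        (simp only: divide_inverse mult_chars_mult[OF \<psi>] mult_chars_inverse[OF \<psi>]
          char_mult_def char_inv_def mult_ac)
    finally show "g (A \<odot> \<psi>) * g (B \<odot> \<psi>) * g (char_inv (A \<odot> char_inv B \<odot> \<psi>)) * g (char_inv \<psi>) *
        \<psi> (- 1) = (\<Sum>t\<in>UNIV. \<Sum>s\<in>UNIV. A t * h (1 + t) * h (1 + s) * \<psi> (- 1 * (t / s)))" .
  qed
  also have "\<dots> = (\<Sum>t\<in>UNIV. \<Sum>s\<in>UNIV. A t * h (1 + t) * h (1 + s) * (\<Sum>\<psi>\<in>mult_chars. \<psi> (- 1 * (t / s))))"
    unfolding sum_distrib_left by (subst sum.swap, subst (2) sum.swap) (rule refl)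
  also have "\<dots> = (\<Sum>t\<in>UNIV. \<Sum>s\<in>UNIV. if s = - t then ?q * (A t * (h (1 + t) * h (1 - t))) else 0)"
  proof (intro sum.cong refl)
    fix t s :: 'a
    show "A t * h (1 + t) * h (1 + s) * (\<Sum>\<psi>\<in>mult_chars. \<psi> (- 1 * (t / s))) =
        (if s = - t then ?q * (A t * (h (1 + t) * h (1 - t))) else 0)"
    \<comment> \<open>At \<open>t = s = 0\<close> the argument of the characters is 0 rather than 1,
      although \<open>s = - t\<close>; the factor \<open>A t\<close> makes both sides zero.\<close>
    proof (cases "t = 0")
      case False
      then have "- 1 * (t / s) = 1 \<longleftrightarrow> s = - t"
        by (cases "s = 0") (auto simp: field_simps)
      then show ?thesis
        unfolding sum_mult_chars by simp
    qed (simp add: mult_chars_zero[OF A])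
  qed
  also have "\<dots> = ?q * g B * (\<Sum>t\<in>UNIV. A t * h (1 - t\<^sup>2))"
    unfolding h_mult by (simp add: sum_distrib_left mult_ac)
  also have "(\<Sum>t\<in>UNIV. A t * h (1 - t\<^sup>2)) = (\<Sum>s\<in>UNIV. \<Sum>t\<in>{t. t\<^sup>2 = s}. A t * h (1 - t\<^sup>2))"
    using sum.group[of "UNIV :: 'a set" UNIV "\<lambda>t. t\<^sup>2" "\<lambda>t. A t * h (1 - t\<^sup>2)"] by simp
  \<comment> \<open>On each fibre of squaring, \<open>h (1 - t\<^sup>2)\<close> is constant, so only
    the sum of \<open>A\<close> over the square roots of \<open>s\<close> remains.\<close>
  also have "\<dots> = (\<Sum>s\<in>UNIV. (\<Sum>R\<in>?Q. R s) * h (1 - s))"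
    unfolding sum_square_root_chars[OF A] sum_distrib_right by (intro sum.cong) auto
  also have "\<dots> = (\<Sum>R\<in>?Q. \<Sum>s\<in>UNIV. R s * h (1 - s))"
    unfolding sum_distrib_right by (rule sum.swap)
  also have "\<dots> = (\<Sum>R\<in>?Q. g R * g (char_inv R \<odot> B) * R (- 1))"
  proof (rule sum.cong[OF refl])
    fix R assume "R \<in> ?Q"
    then have R: "R \<in> mult_chars"
      by simp
    \<comment> \<open>Replacing \<open>s\<close> by \<open>- s\<close> restores the form of
      \<open>gauss_sum_mult\<close> and produces the factor \<open>R (- 1)\<close>.\<close>
    have "(\<Sum>s\<in>UNIV. R s * h (1 - s)) = (\<Sum>s\<in>UNIV. R (s * - 1) * h (1 + s))"
      by (rule sum.reindex_bij_witness[of _ uminus uminus]) auto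
    also have "\<dots> = (\<Sum>s\<in>UNIV. R s * h (1 + s)) * R (- 1)"
      unfolding mult_chars_mult[OF R] sum_distrib_right by (intro sum.cong refl) (simp only: mult_ac)
    finally show "(\<Sum>s\<in>UNIV. R s * h (1 - s)) = g R * g (char_inv R \<odot> B) * R (- 1)"
      by (simp add: g_def h_def gauss_sum_mult[OF \<theta> R B])
  qed
  finally have main: "(\<Sum>\<psi>\<in>mult_chars. g (A \<odot> \<psi>) * g (B \<odot> \<psi>) *
        g (char_inv (A \<odot> char_inv B \<odot> \<psi>)) * g (char_inv \<psi>) * \<psi> (- 1)) =
      ?q * g B * (\<Sum>R\<in>?Q. g R * g (char_inv R \<odot> B) * R (- 1))" .
  have inv: "char_inv (A \<odot> char_inv B) = char_inv A \<odot> B"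
    by (simp add: char_inv_def char_mult_def fun_eq_iff)
  have "hyp2F1 \<theta> A B (A \<odot> char_inv B) (- 1) =
      (\<Sum>\<psi>\<in>mult_chars. g (A \<odot> \<psi>) * g (B \<odot> \<psi>) *
        g (char_inv (A \<odot> char_inv B \<odot> \<psi>)) * g (char_inv \<psi>) * \<psi> (- 1)) /
      (?q * g B * (g A * g (char_inv A \<odot> B)))"
    unfolding hyp2F1_def inv sum_divide_distrib sum_distrib_left
    by (intro sum.cong refl) (simp add: g_def divide_inverse mult_ac)
  \<comment> \<open>The factors \<open>q - 1\<close> and \<open>g B\<close> cancel, both being
    nonzero; the remaining denominator is already that of the claim.\<close>
  also have "\<dots> = (\<Sum>R\<in>?Q. g R * g (char_inv R \<odot> B) * R (- 1)) / (g A * g (char_inv A \<odot> B))"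
    unfolding main using card_minus_1_neq_0[where 'a = 'a] gauss_sum_neq_0[OF assms(1) B]
    by (simp add: g_def)
  finally have eq: "hyp2F1 \<theta> A B (A \<odot> char_inv B) (- 1) =
      (\<Sum>R\<in>?Q. g R * g (char_inv R \<odot> B) * R (- 1) / (g A * g (char_inv A \<odot> B)))"
    by (simp add: sum_divide_distrib)
  \<comment> \<open>If \<open>A\<close> is not a square, the index set \<open>?Q\<close> is empty,
    so the same formula gives both cases.\<close>
  show ?thesis
    unfolding eq g_def by (auto simp: square_char_def intro!: sum.neutral)
qed

end
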